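(* Let $\Lambda=(\Lambda_s)_{s\in\mathcal S}$ be the (coloured) set of control points of a CAP tiling, with all control points in the return module $L$, and let $\Lambda^{\mathrm{Hat}}=(\Lambda^{\mathrm{Hat}}_s)_{s\in\mathcal S}$ be the corresponding (coloured) set of control points of the Hat tiling (all these terms as defined in the context). Let $D:\mathbb R^2_{\mathrm{int}}\to\mathbb R^2$ be the linear map with matrix $$D=\frac1{16}\begin{pmatrix}-11&3\sqrt{15}\\ 3\sqrt{15}&11\end{pmatrix}.$$ Then the set of control points of the Hat tiling is a deformed model set, obtained from the control points of the CAP tiling with $D$ as the linear deformation mapping; that is, for every type $s\in\mathcal S$, $$\Lambda^{\mathrm{Hat}}_s=\{x+Dx^\star : x\in\Lambda_s\}.$$ Moreover, the Hat control points are a reprojection of the CAP control points using the projection $\pi'=\pi+D\,\pi_{\mathrm{int}}:\mathbb R^2\times\mathbb R^2_{\mathrm{int}}\to\mathbb R^2$; that is, $\Lambda^{\mathrm{Hat}}_s=\{\pi'(x,x^\star): x\in\Lambda_s\}$ for every $s\in\mathcal S$.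
   Context: Notation: $\tau=\frac{1+\sqrt5}{2}$, $\xi=e^{2\pi i/6}$, and $\mathbb C$ is identified with $\mathbb R^2$ in the standard way. Return module of the CAP tiling: $L=(3\tau+2-\xi)\,\mathbb Z[\tau,\xi]=\mathbb Zu_1\oplus\mathbb Zu_2\oplus\mathbb Zu_3\oplus\mathbb Zu_4$, with $u_1=3\tau+2-\xi$, $u_2=2\tau+1-\tau\xi+\xi$, $u_3=\xi u_1$, $u_4=\xi u_2$. Star map: $\star:\mathbb Q(\tau,\xi)\to\mathbb Q(\tau,\xi)$ is the field automorphism with $\tau^\star=1-\tau$ and $\xi^\star=\overline\xi=1-\xi$. The set $\mathcal L'=\{(u,u^\star):u\in L\}$ is a lattice in $\mathbb R^2\times\mathbb R^2_{\mathrm{int}}$ (where $\mathbb R^2_{\mathrm{int}}$ is a copy of $\mathbb R^2$ called internal space), and $\pi,\pi_{\mathrm{int}}$ are the canonical projections onto $\mathbb R^2$ and $\mathbb R^2_{\mathrm{int}}$. This is the cut-and-project scheme of the CAP tiling. A model set is a set $\{x\in L:x^\star\in W\}$ with $W\subset\mathbb R^2_{\mathrm{int}}$ relatively compact with non-empty interior. A deformed model set (with linear deformation $\vartheta:\mathbb R^2_{\mathrm{int}}\to\mathbb R^2$) is $\{x+\vartheta(x^\star):x\in\Lambda\}$ for a model set $\Lambda$, where, as usual in this setting, $\Lambda$ may differ from a model set by a set of density $0$. A reprojection of $\Lambda\subset L$ is the image of $\{(x,x^\star):x\in\Lambda\}$ under another linear map $\mathbb R^2\times\mathbb R^2_{\mathrm{int}}\to\mathbb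 R^2$. CAP control points. There are $24$ translational tile types $s=(a,i)\in\mathcal S=\{1,2,3,4\}\times\mathbb Z/6$ (shape $a$, orientation $i$, with representatives $i\in\{1,\dots,6\}$). The inflation has linear factor $\tau^2$ and finite displacement sets $T^{ab}_{ij}\subset L$ (the positions of the control points of tiles of type $(a,i)$ in the inflated tile of type $(b,j)$), which satisfy $T^{ab}_{i+1,j+1}=\xi\,T^{ab}_{ij}$ with indices $i,j$ modulo $6$, and whose non-empty entries with $i=1$ are: $T^{12}_{11}=\{1-\tau-(\tau+2)\xi\}$; $T^{21}_{12}=\{4\tau+1+(\tau+1)\xi\}$; $T^{22}_{11}=\{0,\ 3\tau+1-(3\tau+2)\xi\}$, $T^{22}_{13}=\{4\tau+1+(\tau+1)\xi\}$; $T^{23}_{12}=T^{24}_{12}=\{8\tau+4-(4\tau+2)\xi\}$, $T^{23}_{13}=T^{24}_{13}=\{4\tau+1+(\tau+1)\xi\}$; $T^{32}_{14}=\{-4\tau-3+(5\tau+3)\xi\}$, $T^{32}_{15}=\{-\tau-1+(5\tau+2)\xi\}$, $T^{32}_{16}=\{-5\tau-3+\tau\xi\}$; $T^{33}_{16}=T^{34}_{16}=\{-5\tau-3+\tau\xi\}$; $T^{42}_{12}=\{3\tau+1-(3\tau+2)\xi\}$, $T^{42}_{14}=\{-\tau-2+(2\tau+1)\xi\}$, $T^{42}_{16}=\{-2\tau-2-(2\tau+2)\xi\}$; $T^{43}_{12}=T^{44}_{12}=\{3\tau+1-(3\tau+2)\xi\}$, $T^{43}_{15}=T^{44}_{15}=\{-9\tau-6+(6\tau+3)\xi\}$,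 $T^{44}_{11}=\{2\tau+1-(7\tau+5)\xi\}$. For a family $P=(P_s)_{s\in\mathcal S}$ of subsets of $L$, put $(\varrho P)_{(a,i)}=\bigcup_{(b,j)}\bigcup_{t\in T^{ab}_{ij}}(\tau^2P_{(b,j)}+t)$. Let $P^{(s_0)}$ be the family with $P^{(s_0)}_{s_0}=\{0\}$ and all other members empty. A set of CAP control points in $L$ is a family $\Lambda=(\Lambda_s)_{s\in\mathcal S}$ of subsets of $L$ whose union is relatively dense in $\mathbb R^2$ and such that, for every compact $K\subset\mathbb R^2$, there are $n\ge 0$, $s_0\in\mathcal S$, $v\in L$ with $\Lambda_s\cap K=\big((\varrho^nP^{(s_0)})_s+v\big)\cap K$ for all $s$. It is known from earlier work (Baake, Gähler, Sadun) that CAP control point sets are, type by type and up to a set of density $0$, regular model sets for the cut-and-project scheme $(\mathbb R^2,\mathbb R^2_{\mathrm{int}},\mathcal L')$ with lattice $\mathcal L'=\{(u,u^\star):u\in L\}$, projections $\pi,\pi_{\mathrm{int}}$ and star map $\star$ (that is, the sets $\Lambda_s$ agree, up to density $0$, with sets $\{x\in L:x^\star\in W_s\}$, where $W_s\subset\mathbb R^2_{\mathrm{int}}$ is relatively compact with non-empty interior and boundary of Lebesgue measure $0$; the total window is a hexagon); this may be used. Hat control points. The return module of the Hat tiling is $\frac{\sqrt5}{4}(1+\xi)(\tau-\xi)^3\,\mathbb Z[\xi]$, with generators $v_1=\frac{\sqrt5}{4}\xi(1+\xi)(\tau-\xi)^3$ and $v_2=\xi v_1$. The control points of the Hat tiling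 corresponding to $\Lambda$ are obtained by the shape change that replaces the generating return vectors of the CAP tiling by the corresponding return vectors of the Hat tiling: $\Lambda^{\mathrm{Hat}}_s=\psi(\Lambda_s)$, where $\psi:L\to\mathbb C$ is the $\mathbb Z$-linear map with $$\psi(u_1)=2v_1+v_2,\quad \psi(u_2)=v_1,\quad \psi(u_3)=-v_1+3v_2,\quad \psi(u_4)=v_2 .$$ *)

theory Defs
  imports "HOL-Analysis.Analysis" "HOL-Library.Numeral_Type"
begin

section \<open>The field, the star map and the cut-and-project scheme\<close>

definition tau :: complex where
  "tau = of_real ((1 + sqrt 5) / 2)"

definition xi :: complex where
  "xi = exp (2 * of_real pi * \<i> / 6)"

definition is_subring :: "complex set \<Rightarrow> bool" where
  "is_subring R \<longleftrightarrow> 1 \<in> R \<and> (\<forall>x\<in>R. \<forall>y\<in>R. x - y \<in> R \<and> x * y \<in> R)"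

definition is_subfield :: "complex set \<Rightarrow> bool" where
  "is_subfield F \<longleftrightarrow> is_subring F \<and> (\<forall>x\<in>F. inverse x \<in> F)"

definition Z_tau_xi :: "complex set" where
  "Z_tau_xi = is_subring hull {tau, xi}"

definition Q_tau_xi :: "complex set" where
  "Q_tau_xi = is_subfield hull {tau, xi}"

definition is_star_map :: "(complex \<Rightarrow> complex) \<Rightarrow> bool" where
  "is_star_map \<sigma> \<longleftrightarrow>
     bij_betw \<sigma> Q_tau_xi Q_tau_xi \<and>
     (\<forall>x\<in>Q_tau_xi. \<forall>y\<in>Q_tau_xi. \<sigma> (x + y) = \<sigma> x + \<sigma> y \<and> \<sigma> (x * y) = \<sigma> x * \<sigma> y) \<and>
     \<sigma> tau = 1 - tau \<and> \<sigma> xi = cnj xi"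

text \<open>
  The values of \<open>star\<close> outside \<open>Q_tau_xi\<close> are irrelevant. On \<open>Q_tau_xi\<close> it is well defined: see
  \<open>is_star_map_star\<close> and \<open>is_star_map_unique\<close> below.
\<close>

definition star :: "complex \<Rightarrow> complex" where
  "star = (SOME \<sigma>. is_star_map \<sigma>)"

definition u1 :: complex where "u1 = 3 * tau + 2 - xi"
definition u2 :: complex where "u2 = 2 * tau + 1 - tau * xi + xi"
definition u3 :: complex where "u3 = xi * u1"
definition u4 :: complex where "u4 = xi * u2"

definition L :: "complex set" where
  "L = (\<lambda>z. (3 * tau + 2 - xi) * z) ` Z_tau_xi"

definition embed :: "complex \<Rightarrow> complex \<times> complex" where
  "embed x = (x, star x)"

abbreviation proj_phys :: "complex \<times> complex \<Rightarrow> complex" where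
  "proj_phys \<equiv> fst"

abbreviation proj_int :: "complex \<times> complex \<Rightarrow> complex" where
  "proj_int \<equiv> snd"


section \<open>Model sets, deformed model sets, reprojections\<close>

definition model_set :: "complex set \<Rightarrow> complex set" where
  "model_set W = {x \<in> L. star x \<in> W}"

definition is_window :: "complex set \<Rightarrow> bool" where
  "is_window W \<longleftrightarrow> compact (closure W) \<and> interior W \<noteq> {}"

text \<open>
  Density is taken along centred balls. Finiteness has to be demanded explicitly, since \<open>card\<close> is
  0 on infinite sets and \<open>L\<close> is dense in the plane.
\<close>

definition density_zero :: "complex set \<Rightarrow> bool" where
  "density_zero S \<longleftrightarrow>
     (\<forall>r. finite (S \<inter> cball 0 r)) \<and>
     ((\<lambda>r. real (card (S \<inter> cball 0 r)) / (pi * r\<^sup>2)) \<longlongrightarrow> 0) at_top"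

text \<open>
  A model set up to a set of density 0. That every colour class of a set of CAP control points has
  this property (even with a window whose boundary is a null set) is a theorem of Baake, Gaehler
  and Sadun.
\<close>

definition almost_model_set :: "complex set \<Rightarrow> bool" where
  "almost_model_set X \<longleftrightarrow>
     X \<subseteq> L \<and> (\<exists>W. is_window W \<and> density_zero (sym_diff X (model_set W)))"

definition deformed_model_set :: "(complex \<Rightarrow> complex) \<Rightarrow> complex set \<Rightarrow> bool" where
  "deformed_model_set \<theta> Y \<longleftrightarrow>
     linear \<theta> \<and> (\<exists>X. almost_model_set X \<and> Y = {x + \<theta> (star x) | x. x \<in> X})"

definition is_reprojection ::
    "(complex \<times> complex \<Rightarrow> complex) \<Rightarrow> complex set \<Rightarrow> complex set \<Rightarrow> bool" where
  "is_reprojection p X Y \<longleftrightarrow> X \<subseteq> L \<and> linear p \<and> p \<noteq> proj_phys \<and> Y = p ` (embed ` X)"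


section \<open>Control points of the CAP tiling\<close>

datatype shape = Shape1 | Shape2 | Shape3 | Shape4

text \<open>
  The orientation lives in \<open>\<int>/6\<close>, which is the numeral type \<open>6\<close> (so \<open>6 = 0\<close> there).
\<close>

type_synonym tile_type = "shape \<times> 6"

text \<open>
  \<open>(a, b, j, t)\<close> is in the table iff \<open>t\<close> is in the displacement set
  with upper indices \<open>a b\<close> and lower indices \<open>1 j\<close>.
\<close>

definition displacement_table :: "(shape \<times> shape \<times> 6 \<times> complex) set" where
  "displacement_table =
    {(Shape1, Shape2, 1, 1 - tau - (tau + 2) * xi),
     (Shape2, Shape1, 2, 4 * tau + 1 + (tau + 1) * xi),
     (Shape2, Shape2, 1, 0),
     (Shape2, Shape2, 1, 3 * tau + 1 - (3 * tau + 2) * xi),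
     (Shape2, Shape2, 3, 4 * tau + 1 + (tau + 1) * xi),
     (Shape2, Shape3, 2, 8 * tau + 4 - (4 * tau + 2) * xi),
     (Shape2, Shape4, 2, 8 * tau + 4 - (4 * tau + 2) * xi),
     (Shape2, Shape3, 3, 4 * tau + 1 + (tau + 1) * xi),
     (Shape2, Shape4, 3, 4 * tau + 1 + (tau + 1) * xi),
     (Shape3, Shape2, 4, - 4 * tau - 3 + (5 * tau + 3) * xi),
     (Shape3, Shape2, 5, - tau - 1 + (5 * tau + 2) * xi),
     (Shape3, Shape2, 6, - 5 * tau - 3 + tau * xi),
     (Shape3, Shape3, 6, - 5 * tau - 3 + tau * xi),
     (Shape3, Shape4, 6, - 5 * tau - 3 + tau * xi),
     (Shape4, Shape2, 2, 3 * tau + 1 - (3 * tau + 2) * xi),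
     (Shape4, Shape2, 4, - tau - 2 + (2 * tau + 1) * xi),
     (Shape4, Shape2, 6, - 2 * tau - 2 - (2 * tau + 2) * xi),
     (Shape4, Shape3, 2, 3 * tau + 1 - (3 * tau + 2) * xi),
     (Shape4, Shape4, 2, 3 * tau + 1 - (3 * tau + 2) * xi),
     (Shape4, Shape3, 5, - 9 * tau - 6 + (6 * tau + 3) * xi),
     (Shape4, Shape4, 5, - 9 * tau - 6 + (6 * tau + 3) * xi),
     (Shape4, Shape4, 1, 2 * tau + 1 - (7 * tau + 5) * xi)}"

text \<open>
  The displacement set with upper indices \<open>a b\<close> and lower indices \<open>i j\<close>. It is determined by its
  values for \<open>i = 1\<close> and by the rotation rule, see \<open>displacements_1\<close> and \<open>displacements_rotate\<close>.
\<close>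

definition displacements :: "shape \<Rightarrow> 6 \<Rightarrow> shape \<Rightarrow> 6 \<Rightarrow> complex set" where
  "displacements a i b j =
     {xi ^ k * t | k j0 t. i = 1 + of_nat k \<and> j = j0 + of_nat k \<and> (a, b, j0, t) \<in> displacement_table}"

definition inflation :: "(tile_type \<Rightarrow> complex set) \<Rightarrow> (tile_type \<Rightarrow> complex set)" where
  "inflation P =
     (\<lambda>(a, i). \<Union>(b, j). \<Union>t\<in>displacements a i b j. (\<lambda>x. tau\<^sup>2 * x + t) ` P (b, j))"

definition seed :: "tile_type \<Rightarrow> (tile_type \<Rightarrow> complex set)" where
  "seed s0 = (\<lambda>s. if s = s0 then {0} else {})"

definition relatively_dense :: "complex set \<Rightarrow> bool" where
  "relatively_dense X \<longleftrightarrow> (\<exists>R>0. \<forall>z. \<exists>x\<in>X. dist z x \<le> R)"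

definition CAP_control_points :: "(tile_type \<Rightarrow> complex set) \<Rightarrow> bool" where
  "CAP_control_points \<Lambda> \<longleftrightarrow>
     (\<forall>s. \<Lambda> s \<subseteq> L) \<and>
     relatively_dense (\<Union>s. \<Lambda> s) \<and>
     (\<forall>K. compact K \<longrightarrow>
        (\<exists>n s0. \<exists>v\<in>L. \<forall>s. \<Lambda> s \<inter> K = ((\<lambda>x. x + v) ` ((inflation ^^ n) (seed s0) s)) \<inter> K))"


section \<open>Control points of the Hat tiling\<close>

definition v1 :: complex where
  "v1 = of_real (sqrt 5 / 4) * xi * (1 + xi) * (tau - xi) ^ 3"

definition v2 :: complex where
  "v2 = xi * v1"

text \<open>For maps between abelian groups, \<open>\<int>\<close>-linear means additive.\<close>

definition is_shape_change :: "(complex \<Rightarrow> complex) \<Rightarrow> bool" where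
  "is_shape_change f \<longleftrightarrow>
     (\<forall>x\<in>L. \<forall>y\<in>L. f (x + y) = f x + f y) \<and>
     f u1 = 2 * v1 + v2 \<and> f u2 = v1 \<and> f u3 = - v1 + 3 * v2 \<and> f u4 = v2"

text \<open>
  Well defined on \<open>L\<close> by \<open>is_shape_change_psi\<close> and \<open>is_shape_change_unique\<close>;
  the values elsewhere are irrelevant.
\<close>

definition psi :: "complex \<Rightarrow> complex" where
  "psi = (SOME f. is_shape_change f)"

definition Hat_control_points :: "(tile_type \<Rightarrow> complex set) \<Rightarrow> (tile_type \<Rightarrow> complex set)" where
  "Hat_control_points \<Lambda> = (\<lambda>s. psi ` \<Lambda> s)"


section \<open>The deformation\<close>

definition to_R2 :: "complex \<Rightarrow> real ^ 2" where
  "to_R2 z = vector [Re z, Im z]"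

definition of_R2 :: "real ^ 2 \<Rightarrow> complex" where
  "of_R2 v = Complex (v $ 1) (v $ 2)"

definition D_matrix :: "real ^ 2 ^ 2" where
  "D_matrix = (1 / 16) *\<^sub>R vector [vector [- 11, 3 * sqrt 15], vector [3 * sqrt 15, 11]]"

definition D :: "complex \<Rightarrow> complex" where
  "D z = of_R2 (D_matrix *v to_R2 z)"

definition proj_new :: "complex \<times> complex \<Rightarrow> complex" where
  "proj_new p = proj_phys p + D (proj_int p)"


section \<open>Well-definedness\<close>

lemma xi_Complex: "xi = Complex (1/2) (sqrt 3 / 2)"
proof -
  have "xi = cis (pi / 3)"
    by (simp add: xi_def cis_conv_exp field_simps)
  then show ?thesis
    by (simp add: cis.ctr cos_60 sin_60)
qed

lemma tau_Complex: "tau = Complex ((1 + sqrt 5) / 2) 0"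
  by (simp add: tau_def complex_of_real_def)

lemma tau_sq: "tau * tau = tau + 1"
  by (simp add: tau_Complex complex_eq_iff field_simps)

lemma xi_sq: "xi * xi = xi - 1"
  by (simp add: xi_Complex complex_eq_iff field_simps)

lemma cnj_xi: "cnj xi = 1 - xi"
  by (simp add: xi_Complex complex_eq_iff)

lemma xi_pow6: "xi ^ 6 = 1"
proof -
  have "xi ^ 6 = (xi * xi) * (xi * xi) * (xi * xi)"
    by (simp add: eval_nat_numeral)
  also have "\<dots> = 1"
    by (simp add: xi_sq algebra_simps)
  finally show ?thesis .
qed

text \<open>Coordinates with respect to the rational basis \<open>1, tau, xi, tau * xi\<close>.\<close>

definition lincomb :: "rat \<Rightarrow> rat \<Rightarrow> rat \<Rightarrow> rat \<Rightarrow> complex" where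
  "lincomb a b c d = of_rat a + of_rat b * tau + of_rat c * xi + of_rat d * tau * xi"

lemma of_rat_complex: "(of_rat q :: complex) = of_real (of_rat q)"
proof (cases q)
  case (Fract a b)
  then show ?thesis by (simp add: of_rat_rat)
qed

lemma sqrt5_irrational: "sqrt 5 \<notin> \<rat>"
proof
  assume "sqrt 5 \<in> \<rat>"
  then obtain m n :: nat where "n \<noteq> 0" and s: "\<bar>sqrt 5\<bar> = m / n" and cop: "coprime m n"
    by (rule Rats_abs_nat_div_natE)
  then have "real m = sqrt 5 * real n" by simp
  then have "(real m)\<^sup>2 = 5 * (real n)\<^sup>2" by (simp add: power_mult_distrib)
  then have eq: "m\<^sup>2 = 5 * n\<^sup>2"
    by (metis of_nat_eq_iff of_nat_mult of_nat_numeral of_nat_power)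
  have p5: "prime (5::nat)" by simp
  have "5 dvd m\<^sup>2" using eq by simp
  then have dm: "5 dvd m" by (rule prime_dvd_power[OF p5])
  then obtain k where "m = 5 * k" ..
  with eq have "n\<^sup>2 = 5 * k\<^sup>2" by (simp add: power_mult_distrib)
  then have "5 dvd n\<^sup>2" by simp
  then have "5 dvd n" by (rule prime_dvd_power[OF p5])
  with dm cop show False using coprime_common_divisor_nat by fastforce
qed

lemma real_tau_indep:
  assumes "of_rat a + of_rat b * ((1 + sqrt 5) / 2) = (0::real)"
  shows "a = 0 \<and> b = 0"
proof -
  have "b = 0"
  proof (rule ccontr)
    assume "b \<noteq> 0"
    then have nz: "(of_rat b :: real) \<noteq> 0" by simp
    from assms nz have "sqrt 5 = - 2 * of_rat a / of_rat b - 1"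
      by (simp add: field_simps)
    also have "\<dots> = of_rat (- 2 * a / b - 1)"
      by (simp add: of_rat_diff of_rat_mult of_rat_divide of_rat_minus)
    finally show False using sqrt5_irrational by (metis Rats_of_rat)
  qed
  with assms show ?thesis by simp
qed

lemma lincomb_eq_0:
  assumes "lincomb a b c d = 0"
  shows "a = 0 \<and> b = 0 \<and> c = 0 \<and> d = 0"
proof -
  have "Im (lincomb a b c d) = (of_rat c + of_rat d * ((1 + sqrt 5) / 2)) * (sqrt 3 / 2)"
    by (simp add: lincomb_def of_rat_complex tau_def xi_Complex Im_divide algebra_simps)
       (simp add: field_simps)?
  with assms have "of_rat c + of_rat d * ((1 + sqrt 5) / 2) = (0::real)"
    by simp
  then have cd: "c = 0" "d = 0" using real_tau_indep by auto
  have "Re (lincomb a b c d) = of_rat a + of_rat b * ((1 + sqrt 5) / 2)"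
    by (simp add: lincomb_def of_rat_complex tau_def cd)
  with assms have "a = 0 \<and> b = 0" using real_tau_indep by simp
  with cd show ?thesis by simp
qed

lemma lincomb_add:
  "lincomb a b c d + lincomb a' b' c' d' = lincomb (a + a') (b + b') (c + c') (d + d')"
  by (simp add: lincomb_def of_rat_add algebra_simps)

lemma lincomb_diff:
  "lincomb a b c d - lincomb a' b' c' d' = lincomb (a - a') (b - b') (c - c') (d - d')"
  by (simp add: lincomb_def of_rat_diff algebra_simps)

lemma lincomb_inject:
  "lincomb a b c d = lincomb a' b' c' d' \<longleftrightarrow> a = a' \<and> b = b' \<and> c = c' \<and> d = d'"
  using lincomb_eq_0[of "a - a'" "b - b'" "c - c'" "d - d'"] lincomb_diff[of a b c d a' b' c' d']
  by auto

lemma lincomb_mult: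
  "lincomb a b c d * lincomb a' b' c' d' =
   lincomb
    (a*a' + b*b' - c*c' - d*d')
    (a*b' + b*a' + b*b' - c*d' - d*c' - d*d')
    (a*c' + c*a' + c*c' + b*d' + d*b' + d*d')
    (a*d' + d*a' + b*c' + c*b' + b*d' + d*b' + c*d' + d*c' + d*d')"
proof -
  have gen: "(A + B * t + C * x + E * t * x) * (A' + B' * t + C' * x + E' * t * x) =
     (A*A' + B*B' - C*C' - E*E')
     + (A*B' + B*A' + B*B' - C*E' - E*C' - E*E') * t
     + (A*C' + C*A' + C*C' + B*E' + E*B' + E*E') * x
     + (A*E' + E*A' + B*C' + C*B' + B*E' + E*B' + C*E' + E*C' + E*E') * t * x"
    if "t * t = t + 1" "x * x = x - 1" for A B C E A' B' C' E' t x :: complex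
    using that by algebra
  show ?thesis
    unfolding lincomb_def
    using gen[OF tau_sq xi_sq] by (simp only: of_rat_add of_rat_diff of_rat_mult)
qed

definition lincombs :: "complex set" where
  "lincombs = {lincomb a b c d | a b c d. True}"

lemma lincomb_in [simp]: "lincomb a b c d \<in> lincombs"
  by (auto simp: lincombs_def)

lemma tau_lincomb: "tau = lincomb 0 1 0 0" and xi_lincomb: "xi = lincomb 0 0 1 0"
  and one_lincomb: "1 = lincomb 1 0 0 0" and zero_lincomb: "0 = lincomb 0 0 0 0"
  by (simp_all add: lincomb_def)

definition star_lin :: "complex \<Rightarrow> complex" where
  "star_lin z = (THE w. \<exists>a b c d. z = lincomb a b c d \<and> w = lincomb (a + b + c + d) (- b - d) (- c - d) d)"

lemma star_lin_lincomb:
  "star_lin (lincomb a b c d) = lincomb (a + b + c + d) (- b - d) (- c - d) d"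
  unfolding star_lin_def lincomb_inject by (rule the_equality) auto

lemma lincombs_cases:
  assumes "z \<in> lincombs"
  obtains a b c d where "z = lincomb a b c d"
  using assms by (auto simp: lincombs_def)

lemma star_lin_add:
  "x \<in> lincombs \<Longrightarrow> y \<in> lincombs \<Longrightarrow> star_lin (x + y) = star_lin x + star_lin y"
  by (elim lincombs_cases) (simp add: lincomb_add star_lin_lincomb lincomb_inject algebra_simps)

lemma star_lin_mult:
  "x \<in> lincombs \<Longrightarrow> y \<in> lincombs \<Longrightarrow> star_lin (x * y) = star_lin x * star_lin y"
  by (elim lincombs_cases) (simp add: lincomb_mult star_lin_lincomb lincomb_inject algebra_simps)

lemma star_lin_in: "x \<in> lincombs \<Longrightarrow> star_lin x \<in> lincombs"
  by (elim lincombs_cases) (simp add: star_lin_lincomb)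

lemma star_lin_invol: "x \<in> lincombs \<Longrightarrow> star_lin (star_lin x) = x"
  by (elim lincombs_cases) (simp add: star_lin_lincomb lincomb_inject)

lemma lincombs_inverse:
  assumes "z \<in> lincombs" shows "inverse z \<in> lincombs"
proof (cases "z = 0")
  case True
  then show ?thesis using assms by simp
next
  case False
  from assms obtain a b c d where z: "z = lincomb a b c d" by (elim lincombs_cases)
  define w where "w = lincomb (a + c) (b + d) (- c) (- d)"
  define p where "p = a*a + b*b + a*c + b*d + c*c + d*d"
  define q where "q = 2*a*b + b*b + a*d + b*c + b*d + 2*c*d + d*d"
  have zw: "z * w = lincomb p q 0 0"
    by (simp add: z w_def lincomb_mult lincomb_inject p_def q_def algebra_simps)
  define n where "n = p*p + p*q - q*q"
  have zwv: "z * w * lincomb (p + q) (- q) 0 0 = lincomb n 0 0 0"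
    unfolding zw lincomb_mult lincomb_inject by (simp add: n_def algebra_simps)
  have "w \<noteq> 0"
    using False lincomb_eq_0[of "a + c" "b + d" "- c" "- d"]
    by (auto simp: z w_def zero_lincomb)
  with False zw have pq: "lincomb p q 0 0 \<noteq> 0" by auto
  then have "lincomb (p + q) (- q) 0 0 \<noteq> 0"
    using lincomb_eq_0[of "p + q" "- q" 0 0] by (auto simp: zero_lincomb)
  with pq zw zwv have "lincomb n 0 0 0 \<noteq> 0" by auto
  then have n0: "n \<noteq> 0" by (auto simp: zero_lincomb)
  have "z * (w * lincomb (p + q) (- q) 0 0 * lincomb (1 / n) 0 0 0) = 1"
    using zwv n0 by (simp add: mult.assoc[symmetric] lincomb_mult one_lincomb[symmetric])
  then have "inverse z = w * lincomb (p + q) (- q) 0 0 * lincomb (1 / n) 0 0 0"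
    by (rule inverse_unique)
  then show ?thesis by (simp add: w_def lincomb_mult)
qed

lemma lincombs_subfield: "is_subfield lincombs"
  unfolding is_subfield_def is_subring_def
  using lincombs_inverse
  by (auto simp: one_lincomb lincomb_diff lincomb_mult elim!: lincombs_cases)

lemma is_subring_plus:
  assumes "is_subring R" "x \<in> R" "y \<in> R"
  shows "x + y \<in> R"
proof -
  have "0 \<in> R" using assms unfolding is_subring_def by (metis diff_self)
  then have "0 - y \<in> R" using assms unfolding is_subring_def by blast
  then have "x - (0 - y) \<in> R" using assms unfolding is_subring_def by blast
  then show ?thesis by simp
qed

lemma is_subring_of_int:
  assumes "is_subring R"
  shows "of_int n \<in> R"
proof -
  have 1: "1 \<in> R" using assms by (simp add: is_subring_def)
  then have 0: "0 \<in> R" using assms unfolding is_subring_def by (metis diff_self)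
  have nat: "of_nat k \<in> R" for k
    by (induction k) (use 0 1 in \<open>auto intro: is_subring_plus[OF assms]\<close>)
  show ?thesis
  proof (cases n)
    case (nonneg k)
    then show ?thesis using nat by simp
  next
    case (neg k)
    have "0 - of_nat (Suc k) \<in> R"
      using assms 0 nat unfolding is_subring_def by blast
    then show ?thesis by (simp add: neg)
  qed
qed

lemma is_subfield_of_rat:
  assumes "is_subfield F"
  shows "of_rat q \<in> F"
proof (cases q)
  case (Fract a b)
  have "of_int a * inverse (of_int b) \<in> F"
    using assms is_subring_of_int[of F] unfolding is_subfield_def is_subring_def by blast
  then show ?thesis using Fract(2) by (simp add: Fract(1) of_rat_rat divide_inverse)
qed

lemma Q_tau_xi_eq: "Q_tau_xi = lincombs"
proof
  show "Q_tau_xi \<subseteq> lincombs"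
    unfolding Q_tau_xi_def
    by (rule hull_minimal) (use lincombs_subfield in \<open>auto simp: tau_lincomb xi_lincomb\<close>)
next
  show "lincombs \<subseteq> Q_tau_xi"
    unfolding Q_tau_xi_def hull_def
  proof clarify
    fix z F assume z: "z \<in> lincombs" and F: "is_subfield F" "{tau, xi} \<subseteq> F"
    then have R: "is_subring F" by (simp add: is_subfield_def)
    then have m: "x * y \<in> F" if "x \<in> F" "y \<in> F" for x y
      using that by (simp add: is_subring_def)
    from z show "z \<in> F"
      using F(2) unfolding lincombs_def lincomb_def
      by (auto intro!: is_subring_plus[OF R] m is_subfield_of_rat[OF F(1)])
  qed
qed

lemma is_star_map_star_lin: "is_star_map star_lin"
proof -
  have "bij_betw star_lin lincombs lincombs"
    by (rule bij_betw_byWitness[where f' = star_lin]) (auto simp: star_lin_invol star_lin_in)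
  moreover have "star_lin tau = 1 - tau"
    unfolding tau_lincomb star_lin_lincomb one_lincomb lincomb_diff by simp
  moreover have "star_lin xi = cnj xi"
    unfolding cnj_xi unfolding xi_lincomb star_lin_lincomb one_lincomb lincomb_diff by simp
  ultimately show ?thesis
    by (simp add: is_star_map_def Q_tau_xi_eq star_lin_add star_lin_mult)
qed

theorem is_star_map_star: "is_star_map star"
  unfolding star_def by (rule someI[of is_star_map, OF is_star_map_star_lin])

theorem is_star_map_unique:
  assumes "is_star_map \<sigma>" "is_star_map \<sigma>'" "x \<in> Q_tau_xi"
  shows "\<sigma> x = \<sigma>' x"
proof -
  have *: "f x = star_lin x" if f: "is_star_map f" for f
  proof -
    have add: "f (x + y) = f x + f y" and mult: "f (x * y) = f x * f y"
      if "x \<in> lincombs" "y \<in> lincombs" for x y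
      using f that by (auto simp: is_star_map_def Q_tau_xi_eq)
    have inj: "inj_on f lincombs"
      using f by (auto simp: is_star_map_def Q_tau_xi_eq bij_betw_def)
    have in0: "0 \<in> lincombs" and in1: "1 \<in> lincombs" by (simp_all add: zero_lincomb one_lincomb)
    have f0: "f 0 = 0" using add[OF in0 in0] by simp
    have f1: "f 1 = 1"
    proof -
      have "f 1 \<noteq> f 0" using inj in0 in1 by (metis inj_on_def zero_neq_one)
      then show ?thesis using mult[OF in1 in1] f0 by simp
    qed
    have rin: "of_rat q \<in> lincombs" for q
      using lincombs_subfield by (rule is_subfield_of_rat)
    have fn: "f (of_nat k) = of_nat k" for k
    proof (induction k)
      case (Suc k)
      then show ?case
        using add[OF in1 rin[of "of_nat k"]] f1 by (simp add: of_rat_of_nat_eq)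
    qed (simp add: f0)
    have fi: "f (of_int n) = of_int n" for n
    proof (cases n)
      case (nonneg k)
      then show ?thesis by (simp add: fn)
    next
      case (neg k)
      have "f (of_int n + of_nat (Suc k)) = f (of_int n) + f (of_nat (Suc k))"
        by (rule add) (use rin[of "of_int n"] rin[of "of_nat (Suc k)"] in
          \<open>simp_all only: of_rat_of_int_eq of_rat_of_nat_eq\<close>)
      moreover have "of_int n + of_nat (Suc k) = (0::complex)" by (simp add: neg)
      ultimately have "f (of_int n) = - of_nat (Suc k)"
        by (metis f0 fn add_eq_0_iff2 add.commute)
      then show ?thesis by (simp add: neg)
    qed
    have fr: "f (of_rat q) = of_rat q" for q
    proof (cases q)
      case (Fract a b)
      have "f (of_rat q * of_int b) = f (of_rat q) * of_int b"
        using mult[OF rin[of q] rin[of "of_int b"]] by (simp add: fi)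
      moreover have "of_rat q * of_int b = (of_int a :: complex)"
        using Fract by (simp add: of_rat_rat)
      ultimately show ?thesis
        using Fract fi[of a] by (simp add: of_rat_rat field_simps)
    qed
    obtain a b c d where x: "x = lincomb a b c d"
      using assms(3) by (auto simp: Q_tau_xi_eq elim: lincombs_cases)
    have tin: "tau \<in> lincombs" and xin: "xi \<in> lincombs"
      by (simp_all add: tau_lincomb xi_lincomb)
    have lm: "y * z \<in> lincombs" if "y \<in> lincombs" "z \<in> lincombs" for y z
      using that lincombs_subfield by (simp add: is_subfield_def is_subring_def)
    have la: "y + z \<in> lincombs" if "y \<in> lincombs" "z \<in> lincombs" for y z
      using that lincombs_subfield by (simp add: is_subfield_def is_subring_plus)
    have "f x = of_rat a + of_rat b * (1 - tau) + of_rat c * (1 - xi)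
        + of_rat d * (1 - tau) * (1 - xi)"
      using f unfolding x lincomb_def
      by (simp add: add mult lm la rin tin xin fr is_star_map_def cnj_xi)
    also have "\<dots> = star_lin x"
      unfolding x star_lin_lincomb
      by (simp add: lincomb_def of_rat_add of_rat_diff of_rat_minus algebra_simps)
    finally show ?thesis .
  qed
  show ?thesis using *[OF assms(1)] *[OF assms(2)] by simp
qed

lemma Z_tau_xi_eq:
  "Z_tau_xi = {of_int a + of_int b * tau + of_int c * xi + of_int d * tau * xi | a b c d. True}"
  (is "_ = ?Z")
proof
  have Z: "?Z = {lincomb (of_int a) (of_int b) (of_int c) (of_int d) | a b c d. True}"
    by (simp add: lincomb_def)
  have "is_subring ?Z"
    unfolding is_subring_def
  proof (intro conjI ballI)
    have "1 = lincomb (of_int 1) (of_int 0) (of_int 0) (of_int 0)" by (simp add: one_lincomb)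
    then show "1 \<in> ?Z" unfolding Z by blast
    fix x y assume "x \<in> ?Z" "y \<in> ?Z"
    then obtain a b c d a' b' c' d' where
      x: "x = lincomb (of_int a) (of_int b) (of_int c) (of_int d)" and
      y: "y = lincomb (of_int a') (of_int b') (of_int c') (of_int d')"
      unfolding Z by blast
    show "x - y \<in> ?Z"
      unfolding Z x y lincomb_diff of_int_diff[symmetric] by blast
    show "x * y \<in> ?Z"
      unfolding Z x y lincomb_mult of_int_diff[symmetric] of_int_mult[symmetric] of_int_add[symmetric]
      by blast
  qed
  moreover have "tau \<in> ?Z" "xi \<in> ?Z"
  proof -
    have "tau = of_int 0 + of_int 1 * tau + of_int 0 * xi + of_int 0 * tau * xi"
      and "xi = of_int 0 + of_int 0 * tau + of_int 1 * xi + of_int 0 * tau * xi" by simp_all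
    then show "tau \<in> ?Z" "xi \<in> ?Z" by blast+
  qed
  ultimately show "Z_tau_xi \<subseteq> ?Z"
    unfolding Z_tau_xi_def by (intro hull_minimal) auto
next
  show "?Z \<subseteq> Z_tau_xi"
    unfolding Z_tau_xi_def hull_def
  proof clarify
    fix a b c d F assume R: "is_subring F" and F: "{tau, xi} \<subseteq> F"
    then have m: "x * y \<in> F" if "x \<in> F" "y \<in> F" for x y
      using that by (simp add: is_subring_def)
    show "of_int a + of_int b * tau + of_int c * xi + of_int d * tau * xi \<in> F"
      using F by (auto intro!: is_subring_plus[OF R] m is_subring_of_int[OF R])
  qed
qed

theorem L_eq:
  "L = {of_int a * u1 + of_int b * u2 + of_int c * u3 + of_int d * u4 | a b c d. True}"
  (is "_ = ?M")
proof -
  have u2: "u2 = (tau - 1) * u1"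
    unfolding u1_def u2_def using tau_sq xi_sq by algebra
  have *: "of_int a * u1 + of_int b * u2 + of_int c * u3 + of_int d * u4 =
     (3 * tau + 2 - xi) *
       (of_int (a - b) + of_int b * tau + of_int (c - d) * xi + of_int d * tau * xi)" for a b c d
    unfolding u3_def u4_def u2 by (simp add: u1_def algebra_simps)
  show ?thesis
  proof
    show "L \<subseteq> ?M"
    proof
      fix z assume "z \<in> L"
      then obtain a b c d where z: "z = (3 * tau + 2 - xi) *
          (of_int a + of_int b * tau + of_int c * xi + of_int d * tau * xi)"
        unfolding L_def Z_tau_xi_eq by auto
      have "z = of_int (a + b) * u1 + of_int b * u2 + of_int (c + d) * u3 + of_int d * u4"
        unfolding * z by simp
      then show "z \<in> ?M" by blast
    qed
    show "?M \<subseteq> L"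
      unfolding * L_def Z_tau_xi_eq by blast
  qed
qed

theorem u_independent:
  assumes "of_int a * u1 + of_int b * u2 + of_int c * u3 + of_int d * u4 =
    of_int a' * u1 + of_int b' * u2 + of_int c' * u3 + of_int d' * u4"
  shows "a = a' \<and> b = b' \<and> c = c' \<and> d = d'"
proof -
  have u2: "u2 = (tau - 1) * u1"
    unfolding u1_def u2_def using tau_sq xi_sq by algebra
  have *: "of_int a * u1 + of_int b * u2 + of_int c * u3 + of_int d * u4 =
     u1 * lincomb (of_int (a - b)) (of_int b) (of_int (c - d)) (of_int d)" for a b c d
    unfolding u3_def u4_def u2 by (simp add: lincomb_def of_rat_diff algebra_simps)
  have "u1 = lincomb 2 3 (- 1) 0"
    by (simp add: lincomb_def u1_def of_rat_minus)
  then have "u1 \<noteq> 0" using lincomb_eq_0[of 2 3 "- 1" 0] by auto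
  with assms show ?thesis
    unfolding * by (simp add: lincomb_inject)
qed

definition psi_lin :: "complex \<Rightarrow> complex" where
  "psi_lin x = (THE y. \<exists>a b c d.
     x = of_int a * u1 + of_int b * u2 + of_int c * u3 + of_int d * u4 \<and>
     y = of_int a * (2 * v1 + v2) + of_int b * v1 + of_int c * (- v1 + 3 * v2) + of_int d * v2)"

lemma psi_lin_eq:
  "psi_lin (of_int a * u1 + of_int b * u2 + of_int c * u3 + of_int d * u4) =
     of_int a * (2 * v1 + v2) + of_int b * v1 + of_int c * (- v1 + 3 * v2) + of_int d * v2"
  unfolding psi_lin_def by (rule the_equality) (blast, use u_independent in blast)

theorem is_shape_change_psi: "is_shape_change psi"
proof -
  have "is_shape_change psi_lin"
    unfolding is_shape_change_def
  proof (intro conjI ballI)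
    fix x y assume "x \<in> L" "y \<in> L"
    then obtain a b c d a' b' c' d' where
      x: "x = of_int a * u1 + of_int b * u2 + of_int c * u3 + of_int d * u4" and
      y: "y = of_int a' * u1 + of_int b' * u2 + of_int c' * u3 + of_int d' * u4"
      unfolding L_eq by auto
    have "x + y = of_int (a + a') * u1 + of_int (b + b') * u2 + of_int (c + c') * u3 + of_int (d + d') * u4"
      by (simp add: x y algebra_simps)
    then show "psi_lin (x + y) = psi_lin x + psi_lin y"
      unfolding x y by (simp only: psi_lin_eq) (simp add: algebra_simps)
  next
    show "psi_lin u1 = 2 * v1 + v2" using psi_lin_eq[of 1 0 0 0] by simp
    show "psi_lin u2 = v1" using psi_lin_eq[of 0 1 0 0] by simp
    show "psi_lin u3 = - v1 + 3 * v2" using psi_lin_eq[of 0 0 1 0] by simp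
    show "psi_lin u4 = v2" using psi_lin_eq[of 0 0 0 1] by simp
  qed
  then show ?thesis unfolding psi_def by (rule someI[of is_shape_change])
qed

theorem is_shape_change_unique:
  assumes "is_shape_change f" "is_shape_change g" "x \<in> L"
  shows "f x = g x"
proof -
  have *: "h x = psi_lin x" if h: "is_shape_change h" for h
  proof -
    have add: "h (y + z) = h y + h z" if "y \<in> L" "z \<in> L" for y z
      using h that by (simp add: is_shape_change_def)
    have inL: "of_int a * u1 + of_int b * u2 + of_int c * u3 + of_int d * u4 \<in> L" for a b c d
      unfolding L_eq by blast
    have mL: "of_int n * y \<in> L" if "y \<in> L" for n y
    proof -
      from that obtain a b c d where y: "y = of_int a * u1 + of_int b * u2 + of_int c * u3 + of_int d * u4"
        unfolding L_eq by auto
      show ?thesis using inL[of "n * a" "n * b" "n * c" "n * d"] by (simp add: y algebra_simps)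
    qed
    have aL: "y + z \<in> L" if "y \<in> L" "z \<in> L" for y z
    proof -
      from that obtain a b c d a' b' c' d' where
        y: "y = of_int a * u1 + of_int b * u2 + of_int c * u3 + of_int d * u4" and
        z: "z = of_int a' * u1 + of_int b' * u2 + of_int c' * u3 + of_int d' * u4"
        unfolding L_eq by auto
      show ?thesis
        using inL[of "a + a'" "b + b'" "c + c'" "d + d'"] by (simp add: y z algebra_simps)
    qed
    have 0: "0 \<in> L" using inL[of 0 0 0 0] by simp
    have h0: "h 0 = 0" using add[OF 0 0] by simp
    have hn: "h (of_nat k * y) = of_nat k * h y" if y: "y \<in> L" for k y
    proof (induction k)
      case (Suc k)
      have "of_nat k * y \<in> L" using mL[OF y, of "int k"] by simp
      then show ?case using Suc add[OF y, of "of_nat k * y"] by (simp add: distrib_right)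
    qed (simp add: h0)
    have hi: "h (of_int n * y) = of_int n * h y" if y: "y \<in> L" for n y
    proof (cases n)
      case (nonneg k)
      then show ?thesis by (simp add: hn y)
    next
      case (neg k)
      have "of_nat (Suc k) * y \<in> L" using mL[OF y, of "int (Suc k)"] by simp
      from add[OF mL[OF y] this, of n]
      have "h (of_int n * y + of_nat (Suc k) * y) = h (of_int n * y) + of_nat (Suc k) * h y"
        by (simp only: hn[OF y])
      moreover have "of_int n * y + of_nat (Suc k) * y = 0" by (simp add: neg algebra_simps)
      ultimately have "h (of_int n * y) = - (of_nat (Suc k) * h y)"
        by (simp add: h0 eq_neg_iff_add_eq_0)
      then show ?thesis by (simp add: neg algebra_simps)
    qed
    have u: "u1 \<in> L" "u2 \<in> L" "u3 \<in> L" "u4 \<in> L"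
      using inL[of 1 0 0 0] inL[of 0 1 0 0] inL[of 0 0 1 0] inL[of 0 0 0 1] by simp_all
    from assms(3) obtain a b c d where
      x: "x = of_int a * u1 + of_int b * u2 + of_int c * u3 + of_int d * u4"
      unfolding L_eq by auto
    show ?thesis
      unfolding x psi_lin_eq using h
      by (simp add: add aL mL u hi is_shape_change_def)
  qed
  show ?thesis using *[OF assms(1)] *[OF assms(2)] by simp
qed

lemma xi_pow_of_nat_eq_0:
  assumes "of_nat k = (0::6)"
  shows "xi ^ k = 1"
proof -
  have "CHAR(6) dvd k" using assms by (simp only: of_nat_eq_0_iff_char_dvd)
  then have "6 dvd k" by simp
  then obtain m where "k = 6 * m" by (elim dvdE)
  then show ?thesis by (simp add: power_mult xi_pow6)
qed

theorem displacements_1: "displacements a 1 b j = {t. (a, b, j, t) \<in> displacement_table}"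
proof
  show "displacements a 1 b j \<subseteq> {t. (a, b, j, t) \<in> displacement_table}"
    unfolding displacements_def using xi_pow_of_nat_eq_0 by auto
  show "{t. (a, b, j, t) \<in> displacement_table} \<subseteq> displacements a 1 b j"
    unfolding displacements_def
  proof clarify
    fix t assume "(a, b, j, t) \<in> displacement_table"
    then show "\<exists>k j0 t'. t = xi ^ k * t' \<and> 1 = 1 + of_nat k \<and> j = j0 + of_nat k \<and>
        (a, b, j0, t') \<in> displacement_table"
      by (intro exI[of _ 0] exI[of _ j] exI[of _ t]) simp
  qed
qed

lemma displacements_rotate_subset:
  "(\<lambda>t. xi * t) ` displacements a i b j \<subseteq> displacements a (i + 1) b (j + 1)"
proof clarify
  fix t assume "t \<in> displacements a i b j"
  then obtain k j0 t0 where *: "t = xi ^ k * t0" "i = 1 + of_nat k" "j = j0 + of_nat k"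
      "(a, b, j0, t0) \<in> displacement_table"
    unfolding displacements_def by blast
  then show "xi * t \<in> displacements a (i + 1) b (j + 1)"
    unfolding displacements_def
    by (intro CollectI exI[of _ "Suc k"] exI[of _ j0] exI[of _ t0]) (simp add: algebra_simps)
qed

theorem displacements_rotate:
  "displacements a (i + 1) b (j + 1) = (\<lambda>t. xi * t) ` displacements a i b j"
proof
  show "displacements a (i + 1) b (j + 1) \<subseteq> (\<lambda>t. xi * t) ` displacements a i b j"
  proof
    fix t assume "t \<in> displacements a (i + 1) b (j + 1)"
    then have "xi ^ n * t \<in> displacements a (i + 1 + of_nat n) b (j + 1 + of_nat n)" for n
    proof (induction n)
      case (Suc n)
      then have "xi * (xi ^ n * t) \<in> displacements a (i + 1 + of_nat n + 1) b (j + 1 + of_nat n + 1)"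
        using displacements_rotate_subset by blast
      then show ?case by (simp add: algebra_simps)
    qed simp
    from this[of 5] have "xi ^ 5 * t \<in> displacements a (i + 6) b (j + 6)"
      by (simp add: add.assoc)
    moreover have "(6::6) = 0" by simp
    ultimately have "xi ^ 5 * t \<in> displacements a i b j" by simp
    moreover have "t = xi * (xi ^ 5 * t)"
      using xi_pow6 by (simp add: mult.assoc[symmetric] power_Suc[symmetric] del: power_Suc)
    ultimately show "t \<in> (\<lambda>t. xi * t) ` displacements a i b j" by blast
  qed
qed (rule displacements_rotate_subset)

end

theory Submission
  imports Defs
begin

text \<open>
  The deformation \<open>D\<close> is complex conjugation followed by multiplication by a constant of
  \<open>Q_tau_xi\<close>, since \<open>\<i> * sqrt 15 = (2 * tau - 1) * (2 * xi - 1)\<close>. Hence both \<open>x + D (star x)\<close> and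
  the shape change are additive maps from \<open>L\<close> to \<open>Q_tau_xi\<close>, and they agree because they agree on
  the four generators, which is a computation in the basis \<open>1, tau, xi, tau * xi\<close>.
\<close>

text \<open>A real matrix with rows \<open>(p, q)\<close> and \<open>(q, - p)\<close> sends z to (p
  + q i) times the conjugate of z.\<close>

lemma D_cnj: "D z = Complex (- 11 / 16) (3 * sqrt 15 / 16) * cnj z"
  by (simp add: D_def of_R2_def to_R2_def D_matrix_def matrix_vector_mult_def
      sum_2 complex_eq_iff field_simps)

lemma linear_D: "linear D"
  by (rule linearI) (simp_all add: D_cnj scaleR_conv_of_real algebra_simps)

lemma linear_proj_new: "linear proj_new"
  unfolding proj_new_def
  by (intro linear_compose_add linear_fst linear_compose[OF linear_snd linear_D, unfolded o_def])

text \<open>\<open>is_reprojection\<close> asks for a projection other than the canonical one. The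
  point \<open>(0, 1)\<close> separates the two maps because \<open>D 1\<close> has real part
  -11/16.\<close>

lemma proj_new_neq_fst: "proj_new \<noteq> proj_phys"
proof
  assume "proj_new = proj_phys"
  then have "proj_new (0, 1) = 0" by simp
  then show False by (simp add: proj_new_def D_cnj complex_eq_iff)
qed

text \<open>Additivity of \<open>star\<close> is available only on the field, so \<open>L\<close>
  has to be placed inside it.\<close>

lemma L_subset: "L \<subseteq> Q_tau_xi"
proof -
  have "lincomb 2 3 (- 1) 0 = 3 * tau + 2 - xi"
    by (simp add: lincomb_def of_rat_minus)
  then have gen: "3 * tau + 2 - xi \<in> lincombs" by (metis lincomb_in)
  have "of_int a + of_int b * tau + of_int c * xi + of_int d * tau * xi \<in> lincombs" for a b c d
    using lincomb_in[of "of_int a" "of_int b" "of_int c" "of_int d"] by (simp add: lincomb_def)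
  then show ?thesis
    using gen lincombs_subfield
    unfolding L_def Z_tau_xi_eq Q_tau_xi_eq is_subfield_def is_subring_def by blast
qed

lemma star_add: "x \<in> Q_tau_xi \<Longrightarrow> y \<in> Q_tau_xi \<Longrightarrow> star (x + y) = star x + star y"
  using is_star_map_star by (simp add: is_star_map_def)

text \<open>\<open>star\<close> is a choice, but any two star maps agree on the field, so the
  explicit \<open>star_lin\<close> computes it. Its coordinates come from tau -> 1 - tau and xi -> 1
  - xi.\<close>

lemma star_lincomb: "star (lincomb a b c d) = lincomb (a + b + c + d) (- b - d) (- c - d) d"
proof -
  have "star (lincomb a b c d) = star_lin (lincomb a b c d)"
    by (rule is_star_map_unique[OF is_star_map_star is_star_map_star_lin]) (simp add: Q_tau_xi_eq)
  then show ?thesis by (simp add: star_lin_lincomb)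
qed

lemma of_real_sqrt5: "of_real (sqrt 5) = 2 * tau - 1"
  by (simp add: tau_def field_simps)

lemma cnj_tau: "cnj tau = tau"
  by (simp add: tau_def)

lemma D_star_lincomb:
  "D (star (lincomb a b c d)) =
    lincomb (- 1 / 2) (- 3 / 8) (- 3 / 8) (3 / 4) * lincomb (a + b) (- b) (c + d) (- d)"
proof -
  have "sqrt 15 = sqrt 5 * sqrt 3"
    by (simp add: real_sqrt_mult[symmetric])
  \<comment> \<open>Since \<open>sqrt 5 = 2 * tau - 1\<close> and \<open>sqrt 3\<close> times the
    imaginary unit is \<open>2 * xi - 1\<close>, the constant is
    \<open>- 11 / 16 + 3 / 16 * (1 - 2 * tau - 2 * xi + 4 * tau * xi)\<close>.\<close>
  then have "Complex (- 11 / 16) (3 * sqrt 15 / 16) = lincomb (- 1 / 2) (- 3 / 8) (- 3 / 8) (3 / 4)"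
    by (simp add: lincomb_def of_rat_divide of_rat_minus complex_eq_iff tau_Complex xi_Complex
        field_simps)
  \<comment> \<open>Conjugation undoes \<open>star\<close> on \<open>xi\<close> and fixes
    \<open>tau\<close>, so the composite only replaces \<open>tau\<close> by
    \<open>1 - tau\<close>.\<close>
  moreover have "cnj (star (lincomb a b c d)) = lincomb (a + b) (- b) (c + d) (- d)"
    using cnj_tau
    by (simp add: star_lincomb)
       (simp add: lincomb_def of_rat_complex cnj_xi of_rat_add of_rat_diff of_rat_minus algebra_simps)
  ultimately show ?thesis by (simp add: D_cnj)
qed

lemma u_lincomb:
  "u1 = lincomb 2 3 (- 1) 0" "u2 = lincomb 1 2 1 (- 1)"
  "u3 = lincomb 1 0 1 3" "u4 = lincomb (- 1) 1 2 1"
proof -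
  show u1: "u1 = lincomb 2 3 (- 1) 0" and u2: "u2 = lincomb 1 2 1 (- 1)"
    by (simp_all add: u1_def u2_def lincomb_def of_rat_minus)
  show "u3 = lincomb 1 0 1 3" "u4 = lincomb (- 1) 1 2 1"
    by (simp_all add: u3_def u4_def u1 u2 xi_lincomb lincomb_mult)
qed

text \<open>Because \<open>sqrt 5 = 2 * tau - 1\<close>, the Hat generators lie in the same field
  and can be compared with the deformed CAP generators by rational coordinates.\<close>

lemma v_lincomb:
  "v1 = lincomb (- 1 / 2) (9 / 4) (- 5 / 4) 0" "v2 = lincomb (5 / 4) 0 (- 7 / 4) (9 / 4)"
proof -
  have "of_real (sqrt 5 / 4) = lincomb (- 1 / 4) (1 / 2) 0 0"
    by (simp add: of_real_sqrt5 lincomb_def of_rat_divide of_rat_minus field_simps)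
  moreover have "1 + xi = lincomb 1 0 1 0" "tau - xi = lincomb 0 1 (- 1) 0"
    by (simp_all add: lincomb_def of_rat_minus)
  ultimately show v1: "v1 = lincomb (- 1 / 2) (9 / 4) (- 5 / 4) 0"
    by (simp add: v1_def xi_lincomb lincomb_mult power3_eq_cube)
  show "v2 = lincomb (5 / 4) 0 (- 7 / 4) (9 / 4)"
    by (simp add: v2_def v1 xi_lincomb lincomb_mult)
qed

lemma D_star_u:
  "u1 + D (star u1) = 2 * v1 + v2" "u2 + D (star u2) = v1"
  "u3 + D (star u3) = - v1 + 3 * v2" "u4 + D (star u4) = v2"
proof -
  \<comment> \<open>Integer multiples become repeated sums, so that \<open>lincomb_add\<close> and
    \<open>lincomb_diff\<close> bring each side to a single \<open>lincomb\<close> and injectivity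
    leaves four rational equations.\<close>
  have v: "2 * v1 + v2 = v1 + v1 + v2" "- v1 + 3 * v2 = v2 + v2 + v2 - v1"
    by simp_all
  show "u1 + D (star u1) = 2 * v1 + v2" "u2 + D (star u2) = v1"
    "u3 + D (star u3) = - v1 + 3 * v2" "u4 + D (star u4) = v2"
    unfolding v unfolding u_lincomb v_lincomb D_star_lincomb lincomb_mult lincomb_add lincomb_diff
      lincomb_inject by simp_all
qed

lemma is_shape_change_deformation: "is_shape_change (\<lambda>x. x + D (star x))"
  using L_subset unfolding is_shape_change_def
  by (auto simp: D_star_u star_add linear_add[OF linear_D] subset_iff)

lemma psi_eq_deformation: "x \<in> L \<Longrightarrow> psi x = x + D (star x)"
  by (rule is_shape_change_unique[OF is_shape_change_psi is_shape_change_deformation])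

lemma density_zero_subset:
  assumes "density_zero T" "S \<subseteq> T"
  shows "density_zero S"
  unfolding density_zero_def
proof (intro conjI allI)
  have sub: "S \<inter> cball 0 r \<subseteq> T \<inter> cball 0 r" for r
    using assms by auto
  have fin: "finite (T \<inter> cball 0 r)" for r
    using assms by (simp add: density_zero_def)
  show "finite (S \<inter> cball 0 r)" for r
    using sub fin by (rule finite_subset)
  have lim: "((\<lambda>r. real (card (T \<inter> cball 0 r)) / (pi * r\<^sup>2)) \<longlongrightarrow> 0) at_top"
    using assms by (simp add: density_zero_def)
  \<comment> \<open>The bound holds for every real r: at r = 0 both quotients are 0 by the
    convention for division by zero.\<close>
  have "real (card (S \<inter> cball 0 r)) / (pi * r\<^sup>2) \<le> real (card (T \<inter> cball 0 r)) / (pi * r\<^sup>2)" for r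
    by (intro divide_right_mono) (auto intro!: card_mono[OF fin sub])
  then show "((\<lambda>r. real (card (S \<inter> cball 0 r)) / (pi * r\<^sup>2)) \<longlongrightarrow> 0) at_top"
    by (intro tendsto_sandwich[OF _ _ tendsto_const lim] always_eventually allI) simp_all
qed

lemma density_zero_Un:
  assumes "density_zero S" "density_zero T"
  shows "density_zero (S \<union> T)"
  unfolding density_zero_def
proof (intro conjI allI)
  show "finite ((S \<union> T) \<inter> cball 0 r)" for r
    using assms by (simp add: density_zero_def Int_Un_distrib2)
  have lim: "((\<lambda>r. real (card (S \<inter> cball 0 r)) / (pi * r\<^sup>2) + real (card (T \<inter> cball 0 r)) / (pi * r\<^sup>2))
      \<longlongrightarrow> 0) at_top"
    using assms by (intro tendsto_add_zero) (auto simp: density_zero_def)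
  have "real (card ((S \<union> T) \<inter> cball 0 r)) / (pi * r\<^sup>2) \<le>
      real (card (S \<inter> cball 0 r)) / (pi * r\<^sup>2) + real (card (T \<inter> cball 0 r)) / (pi * r\<^sup>2)" for r
    using card_Un_le[of "S \<inter> cball 0 r" "T \<inter> cball 0 r"]
    unfolding Int_Un_distrib2 add_divide_distrib[symmetric]
    by (intro divide_right_mono) (simp_all flip: of_nat_add)
  then show "((\<lambda>r. real (card ((S \<union> T) \<inter> cball 0 r)) / (pi * r\<^sup>2)) \<longlongrightarrow> 0) at_top"
    by (intro tendsto_sandwich[OF _ _ tendsto_const lim] always_eventually allI) simp_all
qed

text \<open>The union of the windows serves: \<open>model_set\<close> is a preimage under
  \<open>star\<close> and so commutes with unions, and the new error lies in the union of the two
  old ones.\<close>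

lemma almost_model_set_Un:
  assumes "almost_model_set X" "almost_model_set Y"
  shows "almost_model_set (X \<union> Y)"
proof -
  obtain V W where V: "is_window V" "density_zero (sym_diff X (model_set V))"
    and W: "is_window W" "density_zero (sym_diff Y (model_set W))"
    using assms unfolding almost_model_set_def by blast
  have "is_window (V \<union> W)"
    using V(1) W(1) interior_mono[of V "V \<union> W"] unfolding is_window_def by (auto simp: compact_Un)
  moreover have "sym_diff (X \<union> Y) (model_set (V \<union> W))
      \<subseteq> sym_diff X (model_set V) \<union> sym_diff Y (model_set W)"
    by (auto simp: model_set_def)
  then have "density_zero (sym_diff (X \<union> Y) (model_set (V \<union> W)))"
    using density_zero_Un[OF V(2) W(2)] by (rule density_zero_subset[rotated])
  ultimately show ?thesis
    using assms unfolding almost_model_set_def by blast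
qed

text \<open>The induction starts at a singleton, since a window must have non-empty interior and an
  empty union supplies none.\<close>

lemma almost_model_set_UN:
  assumes "finite I" "I \<noteq> {}" "\<And>i. i \<in> I \<Longrightarrow> almost_model_set (X i)"
  shows "almost_model_set (\<Union>i\<in>I. X i)"
  using assms by (induction rule: finite_ne_induct) (auto simp: almost_model_set_Un)

lemma finite_tile_types: "finite (UNIV :: tile_type set)"
proof -
  have "(UNIV :: shape set) \<subseteq> {Shape1, Shape2, Shape3, Shape4}"
    using shape.exhaust by auto
  then have "finite (UNIV :: shape set)" by (rule finite_subset) simp
  then have "finite ((UNIV :: shape set) \<times> (UNIV :: 6 set))"
    by (intro finite_cartesian_product finite_class.finite_UNIV)
  then show ?thesis by (simp only: UNIV_Times_UNIV)
qed

text \<open>The result of Baake, Gaehler and Sadun on the colour classes enters as the premise of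
  the second conjunct. The remaining conjuncts rest on the pointwise identity
  \<open>psi_eq_deformation\<close> on \<open>L\<close>.\<close>

theorem theorem3p3:
  fixes \<Lambda> :: "tile_type \<Rightarrow> complex set"
  assumes "CAP_control_points \<Lambda>"
  shows "(\<forall>s. Hat_control_points \<Lambda> s = {x + D (star x) | x. x \<in> \<Lambda> s})
    \<and> ((\<forall>s. almost_model_set (\<Lambda> s)) \<longrightarrow>
         (\<forall>s. deformed_model_set D (Hat_control_points \<Lambda> s)) \<and>
         deformed_model_set D (\<Union>s. Hat_control_points \<Lambda> s))
    \<and> (\<forall>s. is_reprojection proj_new (\<Lambda> s) (Hat_control_points \<Lambda> s))
    \<and> (\<forall>s. Hat_control_points \<Lambda> s = {proj_new (x, star x) | x. x \<in> \<Lambda> s})"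
proof -
  have L: "\<Lambda> s \<subseteq> L" for s
    using assms unfolding CAP_control_points_def by blast
  have hat: "Hat_control_points \<Lambda> s = (\<lambda>x. x + D (star x)) ` \<Lambda> s" for s
    unfolding Hat_control_points_def using L psi_eq_deformation by (intro image_cong) blast+
  have set: "Hat_control_points \<Lambda> s = {x + D (star x) | x. x \<in> \<Lambda> s}" for s
    unfolding hat by blast
  have deformed: "deformed_model_set D {x + D (star x) | x. x \<in> X}" if "almost_model_set X" for X
    unfolding deformed_model_set_def using that linear_D by blast
  \<comment> \<open>The deformation acts pointwise, so for the uncoloured Hat set it suffices that
    the finite union of CAP colour classes is again almost a model set.\<close>
  have union: "(\<Union>s. Hat_control_points \<Lambda> s) = {x + D (star x) | x. x \<in> (\<Union>s. \<Lambda> s)}"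
    unfolding hat by blast
  show ?thesis
  proof (intro conjI allI impI)
    fix s
    show "Hat_control_points \<Lambda> s = {x + D (star x) | x. x \<in> \<Lambda> s}"
      by (rule set)
    show "Hat_control_points \<Lambda> s = {proj_new (x, star x) | x. x \<in> \<Lambda> s}"
      unfolding set by (simp add: proj_new_def)
    show "is_reprojection proj_new (\<Lambda> s) (Hat_control_points \<Lambda> s)"
      unfolding is_reprojection_def hat
      using L linear_proj_new proj_new_neq_fst by (simp add: image_image embed_def proj_new_def)
  next
    fix s assume "\<forall>s. almost_model_set (\<Lambda> s)"
    then show "deformed_model_set D (Hat_control_points \<Lambda> s)"
      unfolding set by (intro deformed) blast
  next
    assume "\<forall>s. almost_model_set (\<Lambda> s)"
    then show "deformed_model_set D (\<Union>s. Hat_control_points \<Lambda> s)"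
      unfolding union using finite_tile_types by (intro deformed almost_model_set_UN) blast+
  qed
qed

end
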